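(* If $M \models \mathsf{UDLO}$ and $A \subseteq M$, then $\mathrm{acl}(A)$ is the metric closure of $A$.
   Context: A metric linear order is a set with a linear order $\le$ and metric $d$ such that every open ball is order-convex, treated in continuous logic in the language $\{d_\le,r\}$ with $r(x,y)=\inf_{z\le y}d(x,z)$ and $d_\le(x,y)$ the distance from $(x,y)$ to $\{(w,z): w\le z\}$. $\mathsf{UDLO}$ is the theory of complete metric linear orders of diameter $\le1$ whose metric is an ultrametric and such that for every $a$, both $\{d(a,b):b<a\}$ and $\{d(a,b):b>a\}$ are dense in $[0,1]$ (axiomatized by the ultrametric axiom and $\sup_x\inf_y|r(x,y)-p|=0$, $\sup_x\inf_y|r(y,x)-p|=0$ for rational $p\in[0,1]$). A closed nonempty set $D\subseteq M^n$ is $A$-definable if $x\mapsto \inf_{a\in D}d(x,a)$ is a definable predicate with parameters from $A$ (a uniform limit of formulas with parameters from $A$). A point $b$ is algebraic over $A$ if it lies in some compact $A$-definable set; $\mathrm{acl}(A)$ is the set of such points. *)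

theory Defs
  imports "HOL-Analysis.Analysis"
begin

class metric_linorder = linorder + metric_space +
  assumes ball_order_convex:
    "dist c a < e \<Longrightarrow> dist c b < e \<Longrightarrow> a \<le> x \<Longrightarrow> x \<le> b \<Longrightarrow> dist c x < e"

class udlo = metric_linorder + complete_space +
  assumes dist_le_one: "dist a b \<le> 1"
    and ultrametric: "dist a c \<le> max (dist a b) (dist b c)"
    and dense_dist_below: "{0..1} \<subseteq> closure {dist a b |b. b < a}"
    and dense_dist_above: "{0..1} \<subseteq> closure {dist a b |b. a < b}"

definition r :: "'a::metric_linorder \<Rightarrow> 'a \<Rightarrow> real" where
  "r x y = (INF z\<in>{..y}. dist x z)"

text \<open>Powers of a metric structure carry the maximum metric; the library metric on products is the
  Euclidean one.\<close>

definition d_le :: "'a::metric_linorder \<Rightarrow> 'a \<Rightarrow> real" where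
  "d_le x y = (INF (w, z)\<in>{(w, z). w \<le> z}. max (dist x w) (dist y z))"

datatype 'a tm = Var nat | Param 'a

text \<open>In \<open>Conn u \<phi>s\<close> the connective \<open>u\<close> has arity \<open>length \<phi>s\<close>: only its restriction to
  \<open>{..<length \<phi>s} \<rightarrow>\<^sub>E {0..1}\<close> is relevant, and \<open>formula_over\<close> requires this to be a
  continuous map from $[0,1]^n$ to $[0,1]$.\<close>

datatype 'a fm =
    Dist "'a tm" "'a tm"
  | Dle "'a tm" "'a tm"
  | Rel_r "'a tm" "'a tm"
  | Conn "(nat \<Rightarrow> real) \<Rightarrow> real" "'a fm list"
  | Sup_q nat "'a fm"
  | Inf_q nat "'a fm"

fun tm_val :: "'a tm \<Rightarrow> (nat \<Rightarrow> 'a) \<Rightarrow> 'a" where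
  "tm_val (Var i) v = v i"
| "tm_val (Param a) v = a"

fun fm_val :: "'a::metric_linorder fm \<Rightarrow> (nat \<Rightarrow> 'a) \<Rightarrow> real" where
  "fm_val (Dist s t) v = dist (tm_val s v) (tm_val t v)"
| "fm_val (Dle s t) v = d_le (tm_val s v) (tm_val t v)"
| "fm_val (Rel_r s t) v = r (tm_val s v) (tm_val t v)"
| "fm_val (Conn u \<phi>s) v = u (restrict (nth (map (\<lambda>\<phi>. fm_val \<phi> v) \<phi>s)) {..<length \<phi>s})"
| "fm_val (Sup_q i \<phi>) v = (SUP a. fm_val \<phi> (v(i := a)))"
| "fm_val (Inf_q i \<phi>) v = (INF a. fm_val \<phi> (v(i := a)))"

fun tm_vars :: "'a tm \<Rightarrow> nat set" where
  "tm_vars (Var i) = {i}"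
| "tm_vars (Param a) = {}"

fun free_vars :: "'a fm \<Rightarrow> nat set" where
  "free_vars (Dist s t) = tm_vars s \<union> tm_vars t"
| "free_vars (Dle s t) = tm_vars s \<union> tm_vars t"
| "free_vars (Rel_r s t) = tm_vars s \<union> tm_vars t"
| "free_vars (Conn u \<phi>s) = (\<Union>\<phi>\<in>set \<phi>s. free_vars \<phi>)"
| "free_vars (Sup_q i \<phi>) = free_vars \<phi> - {i}"
| "free_vars (Inf_q i \<phi>) = free_vars \<phi> - {i}"

definition connective :: "nat \<Rightarrow> ((nat \<Rightarrow> real) \<Rightarrow> real) \<Rightarrow> bool" where
  "connective n u \<longleftrightarrow>
     continuous_map (product_topology (\<lambda>_. top_of_set {0..1}) {..<n}) (top_of_set {0..1}) u"

fun formula_over :: "'a set \<Rightarrow> 'a fm \<Rightarrow> bool" where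
  "formula_over A (Dist s t) \<longleftrightarrow> set_tm s \<union> set_tm t \<subseteq> A"
| "formula_over A (Dle s t) \<longleftrightarrow> set_tm s \<union> set_tm t \<subseteq> A"
| "formula_over A (Rel_r s t) \<longleftrightarrow> set_tm s \<union> set_tm t \<subseteq> A"
| "formula_over A (Conn u \<phi>s) \<longleftrightarrow> connective (length \<phi>s) u \<and> (\<forall>\<phi>\<in>set \<phi>s. formula_over A \<phi>)"
| "formula_over A (Sup_q i \<phi>) \<longleftrightarrow> formula_over A \<phi>"
| "formula_over A (Inf_q i \<phi>) \<longleftrightarrow> formula_over A \<phi>"

text \<open>An \<open>n\<close>-ary predicate is represented as a function of assignments, of which only the values
  at the variables \<open>0, \<dots>, n - 1\<close> matter.\<close>

definition definable_pred ::
    "'a::metric_linorder set \<Rightarrow> nat \<Rightarrow> ((nat \<Rightarrow> 'a) \<Rightarrow> real) \<Rightarrow> bool" where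
  "definable_pred A n P \<longleftrightarrow>
     (\<exists>\<phi>. (\<forall>k. formula_over A (\<phi> k) \<and> free_vars (\<phi> k) \<subseteq> {..<n}) \<and>
          uniform_limit UNIV (\<lambda>k. fm_val (\<phi> k)) P sequentially)"

definition definable_set :: "'a::metric_linorder set \<Rightarrow> 'a set \<Rightarrow> bool" where
  "definable_set A D \<longleftrightarrow>
     closed D \<and> D \<noteq> {} \<and> definable_pred A 1 (\<lambda>v. infdist (v 0) D)"

definition acl :: "'a::metric_linorder set \<Rightarrow> 'a set" where
  "acl A = {b. \<exists>D. compact D \<and> definable_set A D \<and> b \<in> D}"

end

theory Submission
  imports Defs
begin

text \<open>Fix a mesh \<open>\<delta>\<close> and remember of a pair of points only their order and which of the
  conditions \<open>dist a b \<le> j * \<delta>\<close> with \<open>j \<ge> 1\<close> hold, forgetting the order as well at distance at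
  most \<open>\<delta>\<close>. These conditions are nested convex equivalence relations, each of which splits every
  class of the next one into a dense order without endpoints, so finite families which look alike at
  mesh \<open>\<delta>\<close> extend by back-and-forth with no loss of precision. Letting \<open>\<delta>\<close> tend to 0, the value of a
  formula depends only on the order and the distances of its arguments and parameters. If a ball
  around \<open>b\<close> misses \<open>A\<close>, all its points are related to \<open>A\<close> in the same way, so every
  \<open>A\<close>-definable set containing \<open>b\<close> contains the ball, which is not totally bounded.\<close>

section \<open>Ultrametric linear orders\<close>

lemma dist_mono_between:
  fixes a b c :: "'a::metric_linorder"
  assumes "a \<le> b" "b \<le> c"
  shows "dist a b \<le> dist a c" "dist b c \<le> dist a c"
proof -
  have "dist a b < e \<and> dist c b < e" if "dist a c < e" for e
    using ball_order_convex[of a a e c b] ball_order_convex[of c a e c b] assms that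
      zero_le_dist[of a c]
    by (simp_all add: dist_commute[of c a])
  from this[of "dist a b"] this[of "dist c b"]
  show "dist a b \<le> dist a c" "dist b c \<le> dist a c"
    by (auto simp: dist_commute[of b c] not_less[symmetric])
qed

lemma less_iff_if_near:
  fixes a b c :: "'a::metric_linorder"
  assumes "dist a b < dist a c"
  shows "a < c \<longleftrightarrow> b < c"
  using assms dist_mono_between[of a c b] dist_mono_between[of b c a]
  by (metis dist_commute leD less_imp_le not_le)

lemma dist_eq_if_near:
  fixes a b c :: "'a::udlo"
  assumes "dist a b < dist a c"
  shows "dist b c = dist a c"
  using assms ultrametric[of b c a] ultrametric[of a c b] by (auto simp: dist_commute)

lemma r_eq: "r x y = (if x \<le> y then 0 else dist x y)"
proof -
  have "r x y \<le> dist x z" if "z \<le> y" for z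
    unfolding r_def using that by (intro cINF_lower) (auto intro: bdd_belowI2[where m = 0])
  moreover have "0 \<le> r x y"
    unfolding r_def by (intro cINF_greatest) auto
  moreover have "dist x y \<le> r x y" if "\<not> x \<le> y"
    unfolding r_def using that
    by (intro cINF_greatest) (auto simp: dist_commute[of x] intro: dist_mono_between)
  ultimately show ?thesis
    by (smt (verit) dist_self order_refl)
qed

lemma d_le_eq_r:
  fixes x y :: "'a::udlo"
  shows "d_le x y = r x y"
proof (rule antisym)
  let ?f = "\<lambda>(w, z). max (dist x w) (dist y z)" and ?S = "{(w, z). w \<le> (z::'a)}"
  have "bdd_below (?f ` ?S)"
    by (rule bdd_belowI2[where m = 0]) (auto simp: le_max_iff_disj)
  then have "d_le x y \<le> ?f (w, y)" if "w \<le> y" for w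
    unfolding d_le_def using that by (intro cINF_lower) auto
  then show "d_le x y \<le> r x y"
    unfolding r_def by (intro cINF_greatest) auto
  have "dist x y \<le> max (dist x w) (dist y z)" if "y < x" "w \<le> z" for w z
  proof (rule ccontr)
    assume "\<not> ?thesis"
    then have w: "dist x w < dist x y" and z: "dist y z < dist x y" by auto
    have "dist w y = dist x y" using w by (rule dist_eq_if_near)
    moreover have "y < w"
      using less_iff_if_near[OF w] \<open>y < x\<close> w by (metis less_asym linorder_neqE order_less_irrefl)
    then have "dist y w \<le> dist y z"
      using \<open>w \<le> z\<close> by (intro dist_mono_between) auto
    ultimately show False using z by (simp add: dist_commute)
  qed
  then show "r x y \<le> d_le x y"
    unfolding d_le_def by (intro cINF_greatest) (auto simp: r_eq le_max_iff_disj)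
qed

lemma ex_between_if_dense:
  fixes X T :: "real set"
  assumes "{0..1} \<subseteq> closure X" "finite T" "0 \<le> s" "s < 1" "\<And>t. t \<in> T \<Longrightarrow> s < t"
  shows "\<exists>d\<in>X. s < d \<and> (\<forall>t\<in>T. d < t)"
proof -
  let ?u = "Min (insert 1 T)"
  have "s < ?u" "?u \<le> 1" using assms(2,4,5) by auto
  then have "(s + ?u) / 2 \<in> {s<..<?u} \<inter> closure X"
    using assms(3) by (intro IntI subsetD[OF assms(1)]) auto
  then have "{s<..<?u} \<inter> X \<noteq> {}"
    using open_Int_closure_eq_empty[OF open_greaterThanLessThan, of s ?u X] by blast
  then show ?thesis using assms(2) by auto
qed

lemma ex_greater_dist_between:
  fixes a :: "'a::udlo"
  assumes "finite T" "0 \<le> s" "s < 1" "\<And>t. t \<in> T \<Longrightarrow> s < t"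
  shows "\<exists>b>a. s < dist a b \<and> (\<forall>t\<in>T. dist a b < t)"
  using ex_between_if_dense[OF dense_dist_above assms] by blast

lemma ex_less_dist_between:
  fixes a :: "'a::udlo"
  assumes "finite T" "0 \<le> s" "s < 1" "\<And>t. t \<in> T \<Longrightarrow> s < t"
  shows "\<exists>b<a. s < dist a b \<and> (\<forall>t\<in>T. dist a b < t)"
  using ex_between_if_dense[OF dense_dist_below assms] by blast

text \<open>A finite net of mesh \<open>h / 2\<close> would leave only finitely many values for the distances from the
  centre that exceed \<open>h / 2\<close>, yet these are dense.\<close>

lemma not_compact_if_contains_ball:
  fixes D :: "'a::udlo set"
  assumes "ball b e \<subseteq> D" "0 < e"
  shows "\<not> compact D"
proof
  assume "compact D"
  define h where "h = min e 1"
  have h: "0 < h" "h \<le> e" "h \<le> 1" using \<open>0 < e\<close> by (auto simp: h_def)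
  then obtain X where "finite X" and net: "D \<subseteq> (\<Union>x\<in>X. ball x (h / 2))"
    using \<open>compact D\<close> compact_imp_seq_compact seq_compact_imp_totally_bounded
    by (metis half_gt_zero)
  let ?T = "insert h {t \<in> dist b ` X. h / 2 < t}"
  have "h / 2 < t" if "t \<in> ?T" for t using that h by auto
  then obtain c where "h / 2 < dist b c" and less: "\<forall>t\<in>?T. dist b c < t"
    using ex_greater_dist_between[of ?T "h / 2" b] \<open>finite X\<close> h by auto
  then have "c \<in> D" using assms(1) h by auto
  then obtain x where "x \<in> X" "dist c x < dist c b"
    using net \<open>h / 2 < dist b c\<close> by (force simp: dist_commute)
  moreover from this have "dist b x = dist b c"
    using dist_eq_if_near by (metis dist_commute)
  ultimately show False using less \<open>h / 2 < dist b c\<close> by auto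
qed

section \<open>Signed distances at a given mesh\<close>

text \<open>Closed conditions \<open>dist a b \<le> j * \<delta>\<close> are essential: modulo the points at distance strictly
  less than \<open>s\<close>, a closed ball of radius \<open>s\<close> can be a finite order, so strict inequalities would not
  give dense quotients. Truncation at 0 merges distance 0 with the first step.\<close>

definition level :: "real \<Rightarrow> 'a::metric_space \<Rightarrow> 'a \<Rightarrow> nat" where
  "level \<delta> a b = nat (\<lceil>dist a b / \<delta>\<rceil> - 1)"

definition signed_level :: "real \<Rightarrow> 'a::metric_linorder \<Rightarrow> 'a \<Rightarrow> int" where
  "signed_level \<delta> a b = (if a < b then int (level \<delta> a b) else - int (level \<delta> a b))"

lemma level_self [simp]: "level \<delta> a a = 0"
  by (simp add: level_def)

lemma level_commute: "level \<delta> a b = level \<delta> b a"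
  by (simp add: level_def dist_commute)

lemma level_le_iff: "0 < \<delta> \<Longrightarrow> level \<delta> a b \<le> k \<longleftrightarrow> dist a b \<le> (real k + 1) * \<delta>"
  by (simp add: level_def nat_le_iff diff_le_eq ceiling_le_iff pos_divide_le_eq)

lemma level_eq_iff:
  assumes "0 < \<delta>" "0 < k"
  shows "level \<delta> a b = k \<longleftrightarrow> real k * \<delta> < dist a b \<and> dist a b \<le> (real k + 1) * \<delta>"
proof -
  have "level \<delta> a b = k \<longleftrightarrow> \<not> level \<delta> a b \<le> k - 1 \<and> level \<delta> a b \<le> k"
    using assms(2) by linarith
  then show ?thesis
    using assms(2) unfolding level_le_iff[OF assms(1)] by (simp add: of_nat_diff not_le)
qed

lemma level_mono:
  assumes "0 < \<delta>" "dist a b \<le> dist c d"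
  shows "level \<delta> a b \<le> level \<delta> c d"
  using level_le_iff[OF assms(1), of c d "level \<delta> c d"] assms(2)
  by (simp add: level_le_iff[OF assms(1)])

lemma level_ultrametric:
  fixes a b c :: "'a::udlo"
  assumes "0 < \<delta>"
  shows "level \<delta> a c \<le> max (level \<delta> a b) (level \<delta> b c)"
  using ultrametric[of a c b] level_mono[OF assms, of a c a b] level_mono[OF assms, of a c b c]
  by (auto simp: max_def split: if_splits)

lemma level_mult_mesh_less_one:
  fixes a b :: "'a::udlo"
  assumes "0 < \<delta>"
  shows "real (level \<delta> a b) * \<delta> < 1"
  using level_eq_iff[OF assms, of "level \<delta> a b" a b] dist_le_one[of a b]
  by (cases "level \<delta> a b = 0") auto

lemma dist_approx_level:
  assumes "0 < \<delta>"
  shows "\<bar>dist a b - \<delta> * real (level \<delta> a b)\<bar> \<le> \<delta>"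
proof -
  let ?k = "level \<delta> a b"
  have "dist a b \<le> (real ?k + 1) * \<delta>"
    using level_le_iff[OF assms] by blast
  moreover have "real ?k * \<delta> \<le> dist a b"
    using level_eq_iff[OF assms, of ?k a b] by (cases "?k = 0") auto
  ultimately show ?thesis
    using assms by (auto simp: abs_le_iff algebra_simps)
qed

lemma abs_signed_level: "\<bar>signed_level \<delta> a b\<bar> = int (level \<delta> a b)"
  by (simp add: signed_level_def)

lemma signed_level_self [simp]: "signed_level \<delta> a a = 0"
  by (simp add: signed_level_def)

lemma signed_level_minus: "signed_level \<delta> b a = - signed_level \<delta> a b"
  by (cases a b rule: linorder_cases) (auto simp: signed_level_def level_commute)

lemma level_eq_if_signed_level_eq:
  "signed_level \<delta> a b = signed_level \<delta> c d \<Longrightarrow> level \<delta> a b = level \<delta> c d"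
  by (metis abs_signed_level of_nat_eq_iff)

lemma level_eq_iff_signed_level_eq:
  "level \<delta> a b = k \<longleftrightarrow> signed_level \<delta> a b = int k \<or> signed_level \<delta> b a = int k"
  using level_commute[of \<delta> b a] by (cases a b rule: linorder_cases) (auto simp: signed_level_def)

lemma signed_level_eq_pos_iff:
  "0 < k \<Longrightarrow> signed_level \<delta> a b = int k \<longleftrightarrow> a < b \<and> level \<delta> a b = k"
  by (auto simp: signed_level_def)

lemma signed_level_eq_if_near:
  fixes a b c :: "'a::udlo"
  assumes "dist a b < dist a c"
  shows "signed_level \<delta> a c = signed_level \<delta> b c"
  using dist_eq_if_near[OF assms] less_iff_if_near[OF assms]
  by (simp add: signed_level_def level_def)

lemma signed_level_eq_if_level_less:
  fixes a b c :: "'a::udlo"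
  assumes "0 < \<delta>" "level \<delta> a b < level \<delta> a c"
  shows "signed_level \<delta> a c = signed_level \<delta> b c"
  using assms level_mono[OF assms(1), of a c a b] by (intro signed_level_eq_if_near) linarith

lemma signed_level_eq_trans:
  fixes a b c :: "'a::udlo"
  assumes "0 < \<delta>" "0 < k"
  shows "\<lbrakk>a \<le> b; level \<delta> a b \<le> k; signed_level \<delta> b c = int k\<rbrakk> \<Longrightarrow> signed_level \<delta> a c = int k"
    and "\<lbrakk>signed_level \<delta> a b = int k; b \<le> c; level \<delta> b c \<le> k\<rbrakk> \<Longrightarrow> signed_level \<delta> a c = int k"
proof -
  have mono: "level \<delta> a b \<le> level \<delta> a c" "level \<delta> b c \<le> level \<delta> a c" if "a \<le> b" "b \<le> c"
    using that by (auto intro: level_mono[OF \<open>0 < \<delta>\<close>] dist_mono_between)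
  have "level \<delta> a c \<le> max (level \<delta> a b) (level \<delta> b c)"
    using \<open>0 < \<delta>\<close> by (rule level_ultrametric)
  then show "\<lbrakk>a \<le> b; level \<delta> a b \<le> k; signed_level \<delta> b c = int k\<rbrakk> \<Longrightarrow> signed_level \<delta> a c = int k"
    and "\<lbrakk>signed_level \<delta> a b = int k; b \<le> c; level \<delta> b c \<le> k\<rbrakk> \<Longrightarrow> signed_level \<delta> a c = int k"
    using mono by (auto simp: signed_level_eq_pos_iff[OF \<open>0 < k\<close>])
qed

lemma signed_level_eq_if_farther:
  fixes x y :: "'a::udlo"
  assumes "0 < \<delta>" "signed_level \<delta> p p' = signed_level \<delta> q q'"
    and less: "level \<delta> x p < level \<delta> x p'" and le: "level \<delta> y q \<le> level \<delta> x p"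
  shows "signed_level \<delta> x p' = signed_level \<delta> y q'"
proof -
  have x: "signed_level \<delta> x p' = signed_level \<delta> q q'"
    using signed_level_eq_if_level_less[OF assms(1) less] assms(2) by simp
  then have "level \<delta> q y < level \<delta> q q'"
    using less le level_eq_if_signed_level_eq[OF x] by (simp add: level_commute)
  with x show ?thesis
    using signed_level_eq_if_level_less[OF assms(1)] by simp
qed

section \<open>Back-and-forth at a given mesh\<close>

lemma signed_level_fill_cut:
  fixes L R :: "'a::udlo set"
  assumes "finite L" "finite R" "L \<union> R \<noteq> {}"
    and "0 < \<delta>" "0 < k" "real k * \<delta> < 1"
    and cut: "\<And>p q. p \<in> L \<Longrightarrow> q \<in> R \<Longrightarrow> signed_level \<delta> p q = int k"
    and L: "\<And>p p'. p \<in> L \<Longrightarrow> p' \<in> L \<Longrightarrow> level \<delta> p p' \<le> k"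
    and R: "\<And>q q'. q \<in> R \<Longrightarrow> q' \<in> R \<Longrightarrow> level \<delta> q q' \<le> k"
  shows "\<exists>y. (\<forall>p\<in>L. signed_level \<delta> p y = int k) \<and> (\<forall>q\<in>R. signed_level \<delta> y q = int k)"
proof (cases "L = {}")
  case False
  define m where "m = Max L"
  have m: "m \<in> L" "\<And>p. p \<in> L \<Longrightarrow> p \<le> m" using False assms(1) by (auto simp: m_def)
  let ?T = "insert ((real k + 1) * \<delta>) (dist m ` R)"
  have "real k * \<delta> < t" if "t \<in> ?T" for t
    using that cut[OF m(1)] assms(4,5)
    by (auto simp: signed_level_eq_pos_iff level_eq_iff algebra_simps)
  then obtain y where y: "m < y" "real k * \<delta> < dist m y" "\<forall>t\<in>?T. dist m y < t"
    using ex_greater_dist_between[of ?T "real k * \<delta>" m] assms(2,4,6) by auto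
  then have "level \<delta> m y = k" using assms(4,5) by (simp add: level_eq_iff)
  then have "signed_level \<delta> m y = int k"
    using y(1) assms(5) by (simp add: signed_level_eq_pos_iff)
  then have "signed_level \<delta> p y = int k" if "p \<in> L" for p
    using signed_level_eq_trans(1)[OF assms(4,5)] m(2)[OF that] L[OF that m(1)] by blast
  moreover have "signed_level \<delta> y q = int k" if "q \<in> R" for q
    using signed_level_eq_if_near[of m y q] cut[OF m(1) that] y(3) that by auto
  ultimately show ?thesis by blast
next
  case True
  define m where "m = Min R"
  have m: "m \<in> R" "\<And>q. q \<in> R \<Longrightarrow> m \<le> q" using True assms(2,3) by (auto simp: m_def)
  obtain y where y: "y < m" "real k * \<delta> < dist m y" "dist m y < (real k + 1) * \<delta>"
    using ex_less_dist_between[of "{(real k + 1) * \<delta>}" "real k * \<delta>" m] assms(4,6)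
    by (auto simp: algebra_simps)
  then have "level \<delta> y m = k" using assms(4,5) by (simp add: level_eq_iff dist_commute)
  then have "signed_level \<delta> y m = int k"
    using y(1) assms(5) by (simp add: signed_level_eq_pos_iff)
  then have "signed_level \<delta> y q = int k" if "q \<in> R" for q
    using signed_level_eq_trans(2)[OF assms(4,5)] m(2)[OF that] R[OF m(1) that] by blast
  with True show ?thesis by blast
qed

lemma signed_level_extend_nearest:
  fixes f g :: "'i \<Rightarrow> 'a::udlo"
  assumes "finite I" "0 < \<delta>" "0 < k"
    and sim: "\<And>i j. i \<in> I \<Longrightarrow> j \<in> I \<Longrightarrow> signed_level \<delta> (f i) (f j) = signed_level \<delta> (g i) (g j)"
    and nearest: "\<exists>i\<in>I. level \<delta> x (f i) = k"
  shows "\<exists>y. \<forall>i\<in>I. level \<delta> x (f i) = k \<longrightarrow> signed_level \<delta> x (f i) = signed_level \<delta> y (g i)"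
proof -
  define I_below where "I_below = {i\<in>I. signed_level \<delta> (f i) x = int k}"
  define I_above where "I_above = {i\<in>I. signed_level \<delta> x (f i) = int k}"
  have level_f: "i \<in> I_below \<union> I_above \<longleftrightarrow> i \<in> I \<and> level \<delta> x (f i) = k" for i
    unfolding I_below_def I_above_def by (auto simp: level_eq_iff_signed_level_eq)
  have level_g: "level \<delta> (g i) (g j) \<le> k" if "i \<in> I_below \<union> I_above" "j \<in> I_below \<union> I_above" for i j
    using that[unfolded level_f] level_eq_if_signed_level_eq[OF sim, of i j]
      level_ultrametric[OF \<open>0 < \<delta>\<close>, of "f i" "f j" x] level_commute[of \<delta> "f i" x]
    by simp
  have cut: "signed_level \<delta> (g i) (g j) = int k" if "i \<in> I_below" "j \<in> I_above" for i j
    using that sim signed_level_eq_trans(1)[OF \<open>0 < \<delta>\<close> \<open>0 < k\<close>, of "f i" x "f j"] \<open>0 < k\<close>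
    unfolding I_below_def I_above_def by (auto simp: signed_level_eq_pos_iff)
  obtain i where i: "i \<in> I" "level \<delta> x (f i) = k" using nearest by blast
  then have "real k * \<delta> < 1"
    using level_mult_mesh_less_one[OF \<open>0 < \<delta>\<close>] by blast
  moreover have "finite I_below" "finite I_above"
    using \<open>finite I\<close> unfolding I_below_def I_above_def by auto
  ultimately have "\<exists>y. (\<forall>p\<in>g ` I_below. signed_level \<delta> p y = int k) \<and>
      (\<forall>q\<in>g ` I_above. signed_level \<delta> y q = int k)"
    using i level_f[of i] cut level_g \<open>0 < \<delta>\<close> \<open>0 < k\<close> by (intro signed_level_fill_cut) auto
  then obtain y where y: "\<forall>i\<in>I_below. signed_level \<delta> (g i) y = int k"
    "\<forall>i\<in>I_above. signed_level \<delta> y (g i) = int k" by auto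
  have "signed_level \<delta> x (f i) = signed_level \<delta> y (g i)" if "i \<in> I" "level \<delta> x (f i) = k" for i
  proof -
    have "signed_level \<delta> (f i) x = signed_level \<delta> (g i) y \<or>
        signed_level \<delta> x (f i) = signed_level \<delta> y (g i)"
      using that level_f[of i] y by (auto simp: I_below_def I_above_def)
    then show ?thesis by (metis signed_level_minus)
  qed
  then show ?thesis by blast
qed

lemma signed_level_extend:
  fixes f g :: "'i \<Rightarrow> 'a::udlo"
  assumes "finite I" "0 < \<delta>"
    and sim: "\<And>i j. i \<in> I \<Longrightarrow> j \<in> I \<Longrightarrow> signed_level \<delta> (f i) (f j) = signed_level \<delta> (g i) (g j)"
  shows "\<exists>y. \<forall>i\<in>I. signed_level \<delta> x (f i) = signed_level \<delta> y (g i)"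
proof (cases "I = {}")
  case False
  then obtain n where n: "n \<in> I" "\<And>i. i \<in> I \<Longrightarrow> level \<delta> x (f n) \<le> level \<delta> x (f i)"
    using ex_is_arg_min_if_finite[OF assms(1) False, of "\<lambda>i. level \<delta> x (f i)"]
    by (auto simp: is_arg_min_linorder)
  define k where "k = level \<delta> x (f n)"
  have far: "signed_level \<delta> x (f i) = signed_level \<delta> y (g i)"
    if "i \<in> I" "k < level \<delta> x (f i)" "level \<delta> y (g n) \<le> k" for i y
    using that signed_level_eq_if_farther[OF \<open>0 < \<delta>\<close> sim[OF n(1)]] by (simp add: k_def)
  show ?thesis
  proof (cases "k = 0")
    case True
    have "signed_level \<delta> x (f i) = signed_level \<delta> (g n) (g i)"
      if "i \<in> I" "level \<delta> x (f i) = 0" for i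
      using sim[OF n(1) that(1)] level_ultrametric[OF \<open>0 < \<delta>\<close>, of "f n" "f i" x] that(2) True
        abs_signed_level[of \<delta> x "f i"] abs_signed_level[of \<delta> "f n" "f i"]
      by (simp add: k_def level_commute)
    then show ?thesis using far[of _ "g n"] True by (intro exI[of _ "g n"]) auto
  next
    case False
    then have "\<exists>y. \<forall>i\<in>I. level \<delta> x (f i) = k \<longrightarrow>
      signed_level \<delta> x (f i) = signed_level \<delta> y (g i)"
      using n(1) by (intro signed_level_extend_nearest assms) (auto simp: k_def)
    then obtain y where y: "\<And>i. i \<in> I \<Longrightarrow> level \<delta> x (f i) = k \<Longrightarrow>
      signed_level \<delta> x (f i) = signed_level \<delta> y (g i)" by blast
    have "level \<delta> y (g n) = k"
      using level_eq_if_signed_level_eq[OF y[OF n(1)]] by (simp add: k_def)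
    then show ?thesis using far[of _ y] y n(2) k_def by (metis le_less)
  qed
qed simp

section \<open>Assignments that look alike at a given mesh\<close>

definition terms_over :: "'a set \<Rightarrow> nat set \<Rightarrow> 'a tm set" where
  "terms_over A V = {t. set_tm t \<subseteq> A \<and> tm_vars t \<subseteq> V}"

lemma terms_over_eq: "terms_over A V = Param ` A \<union> Var ` V"
proof -
  have "t \<in> terms_over A V \<longleftrightarrow> t \<in> Param ` A \<union> Var ` V" for t
    by (cases t) (auto simp: terms_over_def)
  then show ?thesis by blast
qed

definition coarsely_similar ::
    "real \<Rightarrow> 'a tm set \<Rightarrow> (nat \<Rightarrow> 'a::metric_linorder) \<Rightarrow> (nat \<Rightarrow> 'a) \<Rightarrow> bool" where
  "coarsely_similar \<delta> T v w \<longleftrightarrow> (\<forall>s\<in>T. \<forall>t\<in>T.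
     signed_level \<delta> (tm_val s v) (tm_val t v) = signed_level \<delta> (tm_val s w) (tm_val t w))"

lemma coarsely_similar_sym: "coarsely_similar \<delta> T v w \<Longrightarrow> coarsely_similar \<delta> T w v"
  unfolding coarsely_similar_def by simp

lemma coarsely_similar_mono: "coarsely_similar \<delta> T v w \<Longrightarrow> S \<subseteq> T \<Longrightarrow> coarsely_similar \<delta> S v w"
  unfolding coarsely_similar_def by blast

lemma coarsely_similar_extend:
  fixes v w :: "nat \<Rightarrow> 'a::udlo"
  assumes "finite A" "finite V" "0 < \<delta>" and sim: "coarsely_similar \<delta> (terms_over A V) v w"
  shows "\<exists>y. coarsely_similar \<delta> (terms_over A (insert i V)) (v(i := x)) (w(i := y))"
proof -
  let ?T = "terms_over A (V - {i})"
  have "finite ?T" using assms(1,2) by (simp add: terms_over_eq)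
  moreover have sim': "coarsely_similar \<delta> ?T v w"
    using sim by (rule coarsely_similar_mono) (auto simp: terms_over_eq)
  ultimately obtain y where
    y: "\<And>t. t \<in> ?T \<Longrightarrow> signed_level \<delta> x (tm_val t v) = signed_level \<delta> y (tm_val t w)"
    using signed_level_extend[of ?T \<delta> "\<lambda>t. tm_val t v" "\<lambda>t. tm_val t w" x] \<open>0 < \<delta>\<close>
    unfolding coarsely_similar_def by blast
  have unchanged: "tm_val t (u(i := z)) = tm_val t u" if "t \<in> ?T" for t z and u :: "nat \<Rightarrow> 'a"
    using that by (cases t) (auto simp: terms_over_def)
  have "signed_level \<delta> (tm_val t v) x = signed_level \<delta> (tm_val t w) y" if "t \<in> ?T" for t
    using y[OF that] by (metis signed_level_minus)
  then have "coarsely_similar \<delta> (insert (Var i) ?T) (v(i := x)) (w(i := y))"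
    using y sim' by (auto simp: coarsely_similar_def unchanged)
  moreover have "terms_over A (insert i V) = insert (Var i) ?T"
    by (auto simp: terms_over_eq)
  ultimately show ?thesis by auto
qed

lemma coarsely_similar_if_near:
  fixes A :: "'a::udlo set"
  assumes near: "\<And>a. a \<in> A \<Longrightarrow> dist b c < dist b a"
  shows "coarsely_similar \<delta> (terms_over A V) (\<lambda>_. b) (\<lambda>_. c)"
proof -
  have "signed_level \<delta> b a = signed_level \<delta> c a" if "a \<in> A" for a
    using near[OF that] by (rule signed_level_eq_if_near)
  moreover from this have "signed_level \<delta> a b = signed_level \<delta> a c" if "a \<in> A" for a
    using that by (metis signed_level_minus)
  ultimately show ?thesis
    by (auto simp: coarsely_similar_def terms_over_eq)
qed

section \<open>Values of formulas\<close>

definition coarsely_continuous ::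
    "'a::metric_linorder set \<Rightarrow> nat set \<Rightarrow> ((nat \<Rightarrow> 'a) \<Rightarrow> real) \<Rightarrow> bool" where
  "coarsely_continuous A V P \<longleftrightarrow> (\<forall>e>0. \<forall>\<^sub>F \<delta> in at_right 0.
     \<forall>v w. coarsely_similar \<delta> (terms_over A V) v w \<longrightarrow> \<bar>P v - P w\<bar> \<le> e)"

lemma coarsely_continuousD:
  assumes "coarsely_continuous A V P" "0 < e"
  shows "\<forall>\<^sub>F \<delta> in at_right 0. 0 < \<delta> \<and>
    (\<forall>v w. coarsely_similar \<delta> (terms_over A V) v w \<longrightarrow> \<bar>P v - P w\<bar> \<le> e)"
  using assms eventually_at_right_less unfolding coarsely_continuous_def
  by (intro eventually_conj) auto

lemma coarsely_continuous_imp_eq: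
  assumes "coarsely_continuous A V P" "\<And>\<delta>. 0 < \<delta> \<Longrightarrow> coarsely_similar \<delta> (terms_over A V) v w"
  shows "P v = P w"
proof -
  have "\<bar>P v - P w\<bar> \<le> e" if "0 < e" for e
    using eventually_happens[OF coarsely_continuousD[OF assms(1) that]] assms(2) by auto
  then have "\<bar>P v - P w\<bar> \<le> 0" by (rule dense_ge)
  then show ?thesis by simp
qed

lemma coarsely_continuous_atomic:
  assumes approx: "\<And>\<delta> a b. 0 < \<delta> \<Longrightarrow> \<bar>f a b - g \<delta> (signed_level \<delta> a b)\<bar> \<le> \<delta>"
    and "s \<in> terms_over A V" "t \<in> terms_over A V"
  shows "coarsely_continuous A V (\<lambda>v. f (tm_val s v) (tm_val t v))"
  unfolding coarsely_continuous_def
proof (intro allI impI)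
  fix e :: real assume "0 < e"
  then have "\<forall>\<^sub>F \<delta> in at_right 0. \<delta> \<in> {0<..<e / 2}"
    by (intro eventually_at_right_real) simp
  then show "\<forall>\<^sub>F \<delta> in at_right 0. \<forall>v w. coarsely_similar \<delta> (terms_over A V) v w \<longrightarrow>
    \<bar>f (tm_val s v) (tm_val t v) - f (tm_val s w) (tm_val t w)\<bar> \<le> e"
  proof eventually_elim
    case (elim \<delta>)
    have "\<bar>f (tm_val s v) (tm_val t v) - f (tm_val s w) (tm_val t w)\<bar> \<le> e"
      if "coarsely_similar \<delta> (terms_over A V) v w" for v w
    proof -
      have "signed_level \<delta> (tm_val s v) (tm_val t v) = signed_level \<delta> (tm_val s w) (tm_val t w)"
        using that assms(2,3) by (simp add: coarsely_similar_def)
      then show ?thesis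
        using approx[of \<delta> "tm_val s v" "tm_val t v"] approx[of \<delta> "tm_val s w" "tm_val t w"] elim
        by auto
    qed
    then show ?case by blast
  qed
qed

lemma coarsely_continuous_dist:
  assumes "s \<in> terms_over A V" "t \<in> terms_over A V"
  shows "coarsely_continuous A V (\<lambda>v. dist (tm_val s v) (tm_val t v))"
proof (rule coarsely_continuous_atomic[OF _ assms])
  fix \<delta> :: real and a b :: 'a assume "0 < \<delta>"
  then show "\<bar>dist a b - \<delta> * \<bar>signed_level \<delta> a b\<bar>\<bar> \<le> \<delta>"
    using dist_approx_level[of \<delta> a b] by (simp add: abs_signed_level)
qed

lemma coarsely_continuous_r:
  assumes "s \<in> terms_over A V" "t \<in> terms_over A V"
  shows "coarsely_continuous A V (\<lambda>v. r (tm_val s v) (tm_val t v))"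
proof (rule coarsely_continuous_atomic[OF _ assms])
  fix \<delta> :: real and a b :: 'a assume "0 < \<delta>"
  then show "\<bar>r a b - \<delta> * max 0 (- signed_level \<delta> a b)\<bar> \<le> \<delta>"
    using dist_approx_level[of \<delta> a b]
    by (cases a b rule: linorder_cases) (auto simp: r_eq signed_level_def)
qed

lemma coarsely_continuous_uminus:
  "coarsely_continuous A V P \<Longrightarrow> coarsely_continuous A V (\<lambda>v. - P v)"
  unfolding coarsely_continuous_def by (simp add: abs_minus_commute)

lemma cSUP_le_cSUP_plus:
  fixes f :: "'a \<Rightarrow> real" and g :: "'b \<Rightarrow> real"
  assumes "bdd_above (range g)" "\<And>x. \<exists>y. f x \<le> g y + e"
  shows "(SUP x. f x) \<le> (SUP y. g y) + e"
proof (rule cSUP_least)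
  fix x
  obtain y where "f x \<le> g y + e" using assms(2) by blast
  then show "f x \<le> (SUP y. g y) + e"
    using cSUP_upper[OF UNIV_I assms(1), of y] by linarith
qed simp

lemma coarsely_continuous_SUP:
  fixes P :: "(nat \<Rightarrow> 'a::udlo) \<Rightarrow> real"
  assumes "finite A" "finite V" "bounded (range P)" and P: "coarsely_continuous A (insert i V) P"
  shows "coarsely_continuous A V (\<lambda>v. SUP a. P (v(i := a)))"
  unfolding coarsely_continuous_def
proof (intro allI impI)
  fix e :: real assume "0 < e"
  have bdd: "bdd_above (range (\<lambda>a. P (v(i := a))))" for v
    using bounded_imp_bdd_above[OF assms(3)] by (rule bdd_above_mono) auto
  show "\<forall>\<^sub>F \<delta> in at_right 0. \<forall>v w. coarsely_similar \<delta> (terms_over A V) v w \<longrightarrow>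
    \<bar>(SUP a. P (v(i := a))) - (SUP a. P (w(i := a)))\<bar> \<le> e"
    using coarsely_continuousD[OF P \<open>0 < e\<close>]
  proof eventually_elim
    case (elim \<delta>)
    have "(SUP a. P (v(i := a))) \<le> (SUP a. P (w(i := a))) + e"
      if sim: "coarsely_similar \<delta> (terms_over A V) v w" for v w
    proof (rule cSUP_le_cSUP_plus[OF bdd])
      fix a
      obtain b where "coarsely_similar \<delta> (terms_over A (insert i V)) (v(i := a)) (w(i := b))"
        using coarsely_similar_extend[OF assms(1,2) _ sim] elim by blast
      then have "\<bar>P (v(i := a)) - P (w(i := b))\<bar> \<le> e" using elim by blast
      then show "\<exists>b. P (v(i := a)) \<le> P (w(i := b)) + e" by (intro exI[of _ b]) simp
    qed
    then show ?case
      using coarsely_similar_sym by (fastforce simp: abs_le_iff)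
  qed
qed

lemma coarsely_continuous_INF:
  fixes P :: "(nat \<Rightarrow> 'a::udlo) \<Rightarrow> real"
  assumes "finite A" "finite V" "bounded (range P)" "coarsely_continuous A (insert i V) P"
  shows "coarsely_continuous A V (\<lambda>v. INF a. P (v(i := a)))"
proof -
  have "bounded (range (\<lambda>v. - P v))"
    using assms(3) by (simp add: bounded_uminus image_image)
  then have "coarsely_continuous A V (\<lambda>v. - (SUP a. - P (v(i := a))))"
    using assms by (intro coarsely_continuous_uminus coarsely_continuous_SUP)
  then show ?thesis by (simp add: Inf_real_def image_image)
qed

lemma dist_fun_le:
  fixes x y :: "'i::countable \<Rightarrow> 'a::metric_space"
  assumes "\<And>i. dist (x i) (y i) \<le> d"
  shows "dist x y \<le> 2 * d"
proof -
  have geometric: "(\<lambda>n. (1 / 2) ^ n * d) sums (2 * d)"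
    using sums_mult2[OF geometric_sums[of "1 / 2 :: real"], of d] by simp
  have "(1 / 2) ^ n * min (dist (x (from_nat n)) (y (from_nat n))) 1 \<le> (1 / 2) ^ n * d" for n
    using assms by (intro mult_left_mono) (auto simp: min_le_iff_disj)
  moreover have "summable (\<lambda>n. (1 / 2) ^ n * min (dist (x (from_nat n)) (y (from_nat n))) 1)"
    by (rule summable_comparison_test'[of "\<lambda>n. (1 / 2) ^ n"]) (auto simp: summable_geometric_iff)
  ultimately have "dist x y \<le> (\<Sum>n. (1 / 2) ^ n * d)"
    unfolding dist_fun_def using sums_summable[OF geometric] by (intro suminf_le)
  also have "\<dots> = 2 * d"
    using geometric by (rule sums_unique[symmetric])
  finally show ?thesis .
qed

lemma connective_uniformly_continuous:
  assumes "connective n u"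
  shows "uniformly_continuous_on (UNIV \<rightarrow>\<^sub>E {0..1}) (\<lambda>x. u (restrict x {..<n}))"
proof (rule compact_uniformly_continuous)
  let ?K = "UNIV \<rightarrow>\<^sub>E {0..1} :: (nat \<Rightarrow> real) set"
  show "compact ?K"
    by (metis compactin_PiE compactin_euclidean_iff compact_Icc euclidean_product_topology)
  have "continuous_map (top_of_set ?K) (product_topology (\<lambda>_. top_of_set {0..1}) {..<n})
      (\<lambda>x. restrict x {..<n})"
    by (auto simp: continuous_map_componentwise continuous_map_in_subtopology
        intro!: continuous_on_subset[OF continuous_on_product_coordinates])
  then have "continuous_map (top_of_set ?K) (top_of_set {0..1}) (u \<circ> (\<lambda>x. restrict x {..<n}))"
    using assms unfolding connective_def by (rule continuous_map_compose)
  then show "continuous_on ?K (\<lambda>x. u (restrict x {..<n}))"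
    by (simp add: continuous_map_in_subtopology o_def)
qed

lemma coarsely_continuous_connective:
  assumes "connective n u"
    and P: "\<And>i. i < n \<Longrightarrow> coarsely_continuous A V (P i)"
    and range_P: "\<And>i v. i < n \<Longrightarrow> P i v \<in> {0..1}"
  shows "coarsely_continuous A V (\<lambda>v. u (restrict (\<lambda>i. P i v) {..<n}))"
  unfolding coarsely_continuous_def
proof (intro allI impI)
  fix e :: real assume "0 < e"
  define Q where "Q v = (\<lambda>i. if i < n then P i v else 0)" for v
  have Q: "Q v \<in> UNIV \<rightarrow>\<^sub>E {0..1}" for v using range_P by (auto simp: Q_def)
  have restrict_Q: "restrict (\<lambda>i. P i v) {..<n} = restrict (Q v) {..<n}" for v
    by (auto simp: Q_def)
  obtain d where "0 < d" and d: "\<And>v w. dist (Q v) (Q w) < d \<Longrightarrow>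
    dist (u (restrict (Q v) {..<n})) (u (restrict (Q w) {..<n})) < e"
    using connective_uniformly_continuous[OF assms(1)] \<open>0 < e\<close> Q
    unfolding uniformly_continuous_on_def by meson
  have "\<forall>\<^sub>F \<delta> in at_right 0. \<forall>i\<in>{..<n}. \<forall>v w. coarsely_similar \<delta> (terms_over A V) v w \<longrightarrow>
      \<bar>P i v - P i w\<bar> \<le> d / 3"
    using P \<open>0 < d\<close> unfolding coarsely_continuous_def
    by (intro eventually_ball_finite) (simp_all del: le_divide_eq_numeral1)
  then show "\<forall>\<^sub>F \<delta> in at_right 0. \<forall>v w. coarsely_similar \<delta> (terms_over A V) v w \<longrightarrow>
    \<bar>u (restrict (\<lambda>i. P i v) {..<n}) - u (restrict (\<lambda>i. P i w) {..<n})\<bar> \<le> e"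
  proof eventually_elim
    case (elim \<delta>)
    have "\<bar>u (restrict (Q v) {..<n}) - u (restrict (Q w) {..<n})\<bar> \<le> e"
      if "coarsely_similar \<delta> (terms_over A V) v w" for v w
    proof -
      have "dist (Q v) (Q w) \<le> 2 * (d / 3)"
        using elim that \<open>0 < d\<close> by (intro dist_fun_le) (auto simp: Q_def dist_real_def)
      then show ?thesis using d[of v w] \<open>0 < d\<close> by (simp add: dist_real_def)
    qed
    then show ?case by (simp add: restrict_Q)
  qed
qed

lemma fm_val_in_unit_interval:
  fixes v :: "nat \<Rightarrow> 'a::udlo"
  shows "formula_over A \<phi> \<Longrightarrow> fm_val \<phi> v \<in> {0..1}"
proof (induction \<phi> arbitrary: v)
  case (Conn u \<phi>s)
  then have "restrict (nth (map (\<lambda>\<phi>. fm_val \<phi> v) \<phi>s)) {..<length \<phi>s} \<in> {..<length \<phi>s} \<rightarrow>\<^sub>E {0..1}"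
    by (auto simp: PiE_iff)
  with Conn.prems show ?case
    by (auto simp: connective_def continuous_map_in_subtopology PiE_iff Pi_iff)
next
  case (Sup_q i \<phi>)
  then have "range (\<lambda>a. fm_val \<phi> (v(i := a))) \<subseteq> {0..1}" by auto
  then show ?case
    unfolding fm_val.simps
    by (intro closed_subset_contains_Sup bdd_above_mono[OF bdd_above_Icc]) auto
next
  case (Inf_q i \<phi>)
  then have "range (\<lambda>a. fm_val \<phi> (v(i := a))) \<subseteq> {0..1}" by auto
  then show ?case
    unfolding fm_val.simps
    by (intro closed_subset_contains_Inf bdd_below_mono[OF bdd_below_Icc]) auto
qed (auto simp: d_le_eq_r r_eq dist_le_one)

lemma bounded_range_fm_val:
  fixes \<phi> :: "'a::udlo fm"
  assumes "formula_over A \<phi>"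
  shows "bounded (range (fm_val \<phi>))"
  using fm_val_in_unit_interval[OF assms]
  by (intro bounded_subset[OF bounded_closed_interval[of 0 1]]) auto

lemma coarsely_continuous_Conn:
  fixes \<phi>s :: "'a::udlo fm list"
  assumes over: "formula_over B (Conn u \<phi>s)"
    and \<phi>s: "\<And>\<phi>. \<phi> \<in> set \<phi>s \<Longrightarrow> coarsely_continuous A V (fm_val \<phi>)"
  shows "coarsely_continuous A V (fm_val (Conn u \<phi>s))"
proof -
  have "fm_val (\<phi>s ! i) v \<in> {0..1}" if "i < length \<phi>s" for i v
    using over that by (intro fm_val_in_unit_interval[of B]) auto
  then have "coarsely_continuous A V (\<lambda>v. u (restrict (\<lambda>i. fm_val (\<phi>s ! i) v) {..<length \<phi>s}))"
    using over \<phi>s by (intro coarsely_continuous_connective) auto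
  moreover have "fm_val (Conn u \<phi>s) =
      (\<lambda>v. u (restrict (\<lambda>i. fm_val (\<phi>s ! i) v) {..<length \<phi>s}))"
    by (rule ext) (simp cong: restrict_cong)
  ultimately show ?thesis by simp
qed

lemma coarsely_continuous_fm_val:
  fixes \<phi> :: "'a::udlo fm"
  assumes "finite A" "formula_over A \<phi>" "finite V" "free_vars \<phi> \<subseteq> V"
  shows "coarsely_continuous A V (fm_val \<phi>)"
  using assms(2-4)
proof (induction \<phi> arbitrary: V)
  case (Dist s t)
  then show ?case
    using coarsely_continuous_dist[of s A V t] by (simp add: terms_over_def)
next
  case (Dle s t)
  then show ?case
    using coarsely_continuous_r[of s A V t] by (simp add: terms_over_def d_le_eq_r)
next
  case (Rel_r s t)
  then show ?case
    using coarsely_continuous_r[of s A V t] by (simp add: terms_over_def)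
next
  case (Conn u \<phi>s)
  then show ?case by (intro coarsely_continuous_Conn[of A] Conn.IH) auto
next
  case (Sup_q i \<phi>)
  then have "coarsely_continuous A V (\<lambda>v. SUP a. fm_val \<phi> (v(i := a)))"
    using bounded_range_fm_val[of A \<phi>] \<open>finite A\<close>
    by (intro coarsely_continuous_SUP Sup_q.IH) auto
  then show ?case by simp
next
  case (Inf_q i \<phi>)
  then have "coarsely_continuous A V (\<lambda>v. INF a. fm_val \<phi> (v(i := a)))"
    using bounded_range_fm_val[of A \<phi>] \<open>finite A\<close>
    by (intro coarsely_continuous_INF Inf_q.IH) auto
  then show ?case by simp
qed

section \<open>Algebraic closure\<close>

lemma finite_set_fm: "finite (set_fm \<phi>)"
proof -
  have "finite (set_tm t)" for t :: "'a tm" by (cases t) auto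
  then show ?thesis by (induction \<phi>) auto
qed

lemma formula_over_iff: "formula_over A \<phi> \<longleftrightarrow> formula_over UNIV \<phi> \<and> set_fm \<phi> \<subseteq> A"
  by (induction \<phi>) auto

lemma fm_val_eq_if_coarsely_similar:
  fixes \<phi> :: "'a::udlo fm"
  assumes "formula_over A \<phi>" "finite V" "free_vars \<phi> \<subseteq> V"
    and sim: "\<And>\<delta>. 0 < \<delta> \<Longrightarrow> coarsely_similar \<delta> (terms_over A V) v w"
  shows "fm_val \<phi> v = fm_val \<phi> w"
proof (rule coarsely_continuous_imp_eq)
  have params: "formula_over (set_fm \<phi>) \<phi>" "set_fm \<phi> \<subseteq> A"
    using assms(1) formula_over_iff[of A \<phi>] formula_over_iff[of "set_fm \<phi>" \<phi>] by simp_all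
  then show "coarsely_continuous (set_fm \<phi>) V (fm_val \<phi>)"
    using finite_set_fm assms(2,3) by (intro coarsely_continuous_fm_val)
  show "coarsely_similar \<delta> (terms_over (set_fm \<phi>) V) v w" if "0 < \<delta>" for \<delta>
    using sim[OF that] by (rule coarsely_similar_mono) (use params(2) in \<open>auto simp: terms_over_eq\<close>)
qed

lemma definable_pred_eq_if_coarsely_similar:
  fixes A :: "'a::udlo set"
  assumes "definable_pred A n P"
    and sim: "\<And>\<delta>. 0 < \<delta> \<Longrightarrow> coarsely_similar \<delta> (terms_over A {..<n}) v w"
  shows "P v = P w"
proof -
  obtain \<phi> where \<phi>: "\<And>k. formula_over A (\<phi> k)" "\<And>k. free_vars (\<phi> k) \<subseteq> {..<n}"
    and lim: "uniform_limit UNIV (\<lambda>k. fm_val (\<phi> k)) P sequentially"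
    using assms(1) unfolding definable_pred_def by auto
  have "(\<lambda>k. fm_val (\<phi> k) v) = (\<lambda>k. fm_val (\<phi> k) w)"
    using fm_val_eq_if_coarsely_similar[OF \<phi>(1) _ \<phi>(2) sim] by auto
  then show ?thesis
    using tendsto_uniform_limitI[OF lim UNIV_I, of v] tendsto_uniform_limitI[OF lim UNIV_I, of w]
      LIMSEQ_unique by auto
qed

lemma ball_subset_definable_set:
  fixes A :: "'a::udlo set"
  assumes "definable_set A D" "b \<in> D" and far: "\<And>a. a \<in> A \<Longrightarrow> e \<le> dist b a"
  shows "ball b e \<subseteq> D"
proof
  fix c assume "c \<in> ball b e"
  then have near: "dist b c < dist b a" if "a \<in> A" for a
    using far[OF that] by simp
  have D: "closed D" "definable_pred A 1 (\<lambda>v. infdist (v 0) D)"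
    using assms(1) by (simp_all add: definable_set_def)
  then have "infdist b D = infdist c D"
    using definable_pred_eq_if_coarsely_similar[OF D(2) coarsely_similar_if_near[OF near]] by auto
  then show "c \<in> D"
    using D(1) \<open>b \<in> D\<close> by (metis empty_iff in_closed_iff_infdist_zero)
qed

lemma acl_subset_closure:
  fixes A :: "'a::udlo set"
  shows "acl A \<subseteq> closure A"
proof
  fix b assume "b \<in> acl A"
  then obtain D where D: "compact D" "definable_set A D" "b \<in> D" by (auto simp: acl_def)
  show "b \<in> closure A"
  proof (rule ccontr)
    assume "b \<notin> closure A"
    then obtain e where e: "0 < e" "\<And>a. a \<in> A \<Longrightarrow> e \<le> dist b a"
      by (auto simp: closure_approachable dist_commute not_less)
    then show False
      using ball_subset_definable_set[OF D(2,3)] not_compact_if_contains_ball D(1) by blast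
  qed
qed

lemma definable_singleton:
  fixes A :: "'a::metric_linorder set"
  assumes "b \<in> closure A"
  shows "definable_set A {b}"
proof -
  obtain a where a: "\<And>k. a k \<in> A" "a \<longlonglongrightarrow> b" using assms by (auto simp: closure_sequential)
  define \<phi> where "\<phi> k = Dist (Var 0) (Param (a k))" for k
  have "uniform_limit UNIV (\<lambda>k. fm_val (\<phi> k)) (\<lambda>v. infdist (v 0) {b}) sequentially"
  proof (rule uniform_limitI)
    fix e :: real assume "0 < e"
    with a(2) have "\<forall>\<^sub>F k in sequentially. dist (a k) b < e" by (rule tendstoD)
    then show "\<forall>\<^sub>F k in sequentially. \<forall>v\<in>UNIV. dist (fm_val (\<phi> k) v) (infdist (v 0) {b}) < e"
    proof eventually_elim
      case (elim k)
      have "\<bar>dist x (a k) - dist x b\<bar> \<le> dist (a k) b" for x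
        by (metis abs_dist_diff_le dist_commute)
      with elim show ?case by (auto simp: \<phi>_def dist_real_def intro: le_less_trans)
    qed
  qed
  moreover have "formula_over A (\<phi> k)" "free_vars (\<phi> k) \<subseteq> {..<1}" for k
    using a(1) by (auto simp: \<phi>_def)
  ultimately show ?thesis
    unfolding definable_set_def definable_pred_def by auto
qed

lemma closure_subset_acl:
  fixes A :: "'a::metric_linorder set"
  shows "closure A \<subseteq> acl A"
proof
  fix b assume "b \<in> closure A"
  then have "compact {b}" "definable_set A {b}" "b \<in> {b}" by (auto intro: definable_singleton)
  then show "b \<in> acl A" unfolding acl_def by blast
qed

theorem theorem4p34:
  fixes A :: "'a::udlo set"
  shows "acl A = closure A"
  using acl_subset_closure closure_subset_acl by (rule equalityI)

end
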